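(* Let $E$ and $X$ be non-empty path-connected topological spaces and let $p:E\to X$ be a continuous map. Consider the following properties of $p$: (1) $p$ is a Hurewicz fibration with totally path-disconnected fibers; (2) $p$ has the continuous path-covering property; (3) $p$ is a Serre fibration with totally path-disconnected fibers; (4) $p$ has the path-covering property. Then (1) $\Rightarrow$ (2) $\Rightarrow$ (3) $\Rightarrow$ (4).
   Context: Maps are continuous. Let $I=[0,1]$. For a space $Y$ and $y\in Y$, $P(Y,y)$ is the space of paths $\alpha:I\to Y$ with $\alpha(0)=y$, with the compact-open topology. A map $p:E\to X$ induces $P(p):P(E,e)\to P(X,p(e))$, $\alpha\mapsto p\circ\alpha$. The map $p$ has the path-covering property if $P(p):P(E,e)\to P(X,p(e))$ is a bijection for every $e\in E$, and the continuous path-covering property if $P(p):P(E,e)\to P(X,p(e))$ is a homeomorphism for every $e\in E$. A map $p:E\to X$ has the homotopy lifting property with respect to a space $Z$ if for all maps $f:Z\to E$ and $g:Z\times I\to X$ with $p(f(z))=g(z,0)$ for all $z$, there is a map $\widetilde{g}:Z\times I\to E$ with $p\circ\widetilde{g}=g$ and $\widetilde{g}(z,0)=f(z)$ for all $z$. A Hurewicz fibration is a map with the homotopy lifting property with respect to all topological spaces; a Serre fibration is a map with the homotopy lifting property with respect to $I^n$ for all $n\ge 0$. A space is totally path-disconnected if every path in it is constant. *)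

theory Defs
  imports "HOL-Analysis.Analysis"
begin

abbreviation unit_interval :: "real topology" where
  "unit_interval \<equiv> subtopology euclideanreal {0..1}"

text \<open>
  A map out of \<open>A\<close> is represented by its unique representative in
  \<open>extensional (topspace A)\<close>, i.e. the one with value \<open>undefined\<close> off \<open>topspace A\<close>.
  Taking \<open>K = {}\<close> shows that the whole set of maps is open.
\<close>

definition compact_open_topology :: "'a topology \<Rightarrow> 'b topology \<Rightarrow> ('a \<Rightarrow> 'b) topology" where
  "compact_open_topology A Y =
     topology_generated_by
       {{\<alpha>. continuous_map A Y \<alpha> \<and> \<alpha> \<in> extensional (topspace A) \<and> \<alpha> ` K \<subseteq> U} | K U.
          compactin A K \<and> openin Y U}"

definition path_space :: "'a topology \<Rightarrow> 'a \<Rightarrow> (real \<Rightarrow> 'a) topology" where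
  "path_space Y y = subtopology (compact_open_topology unit_interval Y) {\<alpha>. \<alpha> 0 = y}"

text \<open>
  The induced map \<open>P(p)\<close> is \<open>\<alpha> \<mapsto> p \<circ> \<alpha>\<close>, with the composite again taken to be
  \<open>undefined\<close> off \<open>{0..1}\<close>.
\<close>

definition path_map :: "('a \<Rightarrow> 'b) \<Rightarrow> (real \<Rightarrow> 'a) \<Rightarrow> (real \<Rightarrow> 'b)" where
  "path_map p = compose {0..1} p"

definition path_covering_property :: "'a topology \<Rightarrow> 'b topology \<Rightarrow> ('a \<Rightarrow> 'b) \<Rightarrow> bool" where
  "path_covering_property E X p \<longleftrightarrow>
     (\<forall>e \<in> topspace E.
        bij_betw (path_map p) (topspace (path_space E e)) (topspace (path_space X (p e))))"

definition continuous_path_covering_property :: "'a topology \<Rightarrow> 'b topology \<Rightarrow> ('a \<Rightarrow> 'b) \<Rightarrow> bool"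
  where
  "continuous_path_covering_property E X p \<longleftrightarrow>
     (\<forall>e \<in> topspace E. homeomorphic_map (path_space E e) (path_space X (p e)) (path_map p))"

definition homotopy_lifting_property ::
  "'a topology \<Rightarrow> 'b topology \<Rightarrow> ('a \<Rightarrow> 'b) \<Rightarrow> 'z topology \<Rightarrow> bool" where
  "homotopy_lifting_property E X p Z \<longleftrightarrow>
     (\<forall>f g. continuous_map Z E f \<longrightarrow>
            continuous_map (prod_topology Z unit_interval) X g \<longrightarrow>
            (\<forall>z \<in> topspace Z. p (f z) = g (z, 0)) \<longrightarrow>
            (\<exists>h. continuous_map (prod_topology Z unit_interval) E h \<and>
                 (\<forall>z \<in> topspace Z. \<forall>t \<in> {0..1}. p (h (z, t)) = g (z, t)) \<and>
                 (\<forall>z \<in> topspace Z. h (z, 0) = f z)))"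

text \<open>
  HOL cannot quantify over types inside a formula, so ``all topological spaces'' has to be
  read as ``all topologies whose points are taken from one type''.
  With the type \<open>'a \<times> (real \<Rightarrow> 'b)\<close> chosen here nothing is lost:
  \<open>hurewicz_fibration_imp_homotopy_lifting_property\<close> below shows that the homotopy
  lifting property then holds for every topological space over every type.
\<close>

definition hurewicz_fibration :: "'a topology \<Rightarrow> 'b topology \<Rightarrow> ('a \<Rightarrow> 'b) \<Rightarrow> bool" where
  "hurewicz_fibration E X p \<longleftrightarrow>
     continuous_map E X p \<and>
     (\<forall>Z :: ('a \<times> (real \<Rightarrow> 'b)) topology. homotopy_lifting_property E X p Z)"

definition cube :: "nat \<Rightarrow> (nat \<Rightarrow> real) topology" where
  "cube n = product_topology (\<lambda>_. unit_interval) {..<n}"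

definition serre_fibration :: "'a topology \<Rightarrow> 'b topology \<Rightarrow> ('a \<Rightarrow> 'b) \<Rightarrow> bool" where
  "serre_fibration E X p \<longleftrightarrow>
     continuous_map E X p \<and> (\<forall>n. homotopy_lifting_property E X p (cube n))"

definition totally_path_disconnected_space :: "'a topology \<Rightarrow> bool" where
  "totally_path_disconnected_space Y \<longleftrightarrow>
     (\<forall>\<alpha>. pathin Y \<alpha> \<longrightarrow> (\<exists>c. \<forall>t \<in> {0..1}. \<alpha> t = c))"

definition totally_path_disconnected_fibers :: "'a topology \<Rightarrow> 'b topology \<Rightarrow> ('a \<Rightarrow> 'b) \<Rightarrow> bool"
  where
  "totally_path_disconnected_fibers E X p \<longleftrightarrow>
     (\<forall>x \<in> topspace X.
        totally_path_disconnected_space (subtopology E {e \<in> topspace E. p e = x}))"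


lemma topspace_compact_open_topology:
  "topspace (compact_open_topology A Y) =
     {\<alpha>. continuous_map A Y \<alpha> \<and> \<alpha> \<in> extensional (topspace A)}"
proof -
  have "\<exists>K U. compactin A K \<and> openin Y U \<and> \<alpha> ` K \<subseteq> U" for \<alpha>
    by (intro exI[of _ "{}"]) auto
  then show ?thesis
    unfolding compact_open_topology_def topology_generated_by_topspace by blast
qed

lemma openin_compact_open_topology:
  assumes "compactin A K" "openin Y U"
  shows "openin (compact_open_topology A Y)
           {\<alpha>. continuous_map A Y \<alpha> \<and> \<alpha> \<in> extensional (topspace A) \<and> \<alpha> ` K \<subseteq> U}"
  unfolding compact_open_topology_def
  by (rule topology_generated_by_Basis) (use assms in blast)

lemma continuous_map_curry:
  assumes g: "continuous_map (prod_topology Z A) Y g"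
  shows "continuous_map Z (compact_open_topology A Y)
           (\<lambda>z. restrict (\<lambda>a. g (z, a)) (topspace A))"
proof -
  have slice: "continuous_map A Y (restrict (\<lambda>a. g (z, a)) (topspace A))"
    if z: "z \<in> topspace Z" for z
  proof -
    have "continuous_map A (prod_topology Z A) (\<lambda>a. (z, a))"
      using z by (simp add: continuous_map_pairedI)
    from continuous_map_compose[OF this g] show ?thesis
      by (auto intro: continuous_map_eq simp: o_def)
  qed
  have op: "openin Z {z \<in> topspace Z. \<forall>a \<in> K. g (z, a) \<in> U}"
    if K: "compactin A K" and U: "openin Y U" for K U
  proof (subst openin_subopen, intro ballI)
    fix z assume z: "z \<in> {z \<in> topspace Z. \<forall>a \<in> K. g (z, a) \<in> U}"
    let ?W = "{w \<in> topspace (prod_topology Z A). g w \<in> U}"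
    have KA: "K \<subseteq> topspace A" using K by (rule compactin_subset_topspace)
    have W: "openin (prod_topology Z A) ?W"
      using g U by (rule openin_continuous_map_preimage)
    have "\<exists>V V'. openin Z V \<and> openin A V' \<and> z \<in> V \<and> K \<subseteq> V' \<and> V \<times> V' \<subseteq> ?W"
      by (rule tube_lemma_right[OF W K]) (use z KA in auto)
    then obtain V V' where V: "openin Z V" "z \<in> V" "K \<subseteq> V'" "V \<times> V' \<subseteq> ?W" by blast
    then have "V \<subseteq> {z \<in> topspace Z. \<forall>a \<in> K. g (z, a) \<in> U}"
      using openin_subset by fastforce
    with V show "\<exists>T. openin Z T \<and> z \<in> T \<and> T \<subseteq> {z \<in> topspace Z. \<forall>a \<in> K. g (z, a) \<in> U}"
      by blast
  qed
  let ?c = "\<lambda>z. restrict (\<lambda>a. g (z, a)) (topspace A)"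
  show ?thesis
    unfolding compact_open_topology_def
  proof (rule continuous_on_generated_topo)
    fix S
    assume "S \<in> {{\<alpha>. continuous_map A Y \<alpha> \<and> \<alpha> \<in> extensional (topspace A) \<and> \<alpha> ` K \<subseteq> U} | K U.
          compactin A K \<and> openin Y U}"
    then obtain K U where K: "compactin A K" and U: "openin Y U"
      and S: "S = {\<alpha>. continuous_map A Y \<alpha> \<and> \<alpha> \<in> extensional (topspace A) \<and> \<alpha> ` K \<subseteq> U}"
      by blast
    have KA: "K \<subseteq> topspace A" using K by (rule compactin_subset_topspace)
    have "?c -` S \<inter> topspace Z = {z \<in> topspace Z. \<forall>a \<in> K. g (z, a) \<in> U}"
      using KA slice unfolding S by (auto simp: image_subset_iff subset_iff)
    then show "openin Z (?c -` S \<inter> topspace Z)"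
      using op[OF K U] by simp
  next
    show "?c ` topspace Z \<subseteq>
      \<Union> {{\<alpha>. continuous_map A Y \<alpha> \<and> \<alpha> \<in> extensional (topspace A) \<and> \<alpha> ` K \<subseteq> U} | K U.
          compactin A K \<and> openin Y U}"
      using slice topspace_compact_open_topology[of A Y]
      unfolding compact_open_topology_def topology_generated_by_topspace by auto
  qed
qed

lemma continuous_map_path_eval:
  "continuous_map (prod_topology (compact_open_topology unit_interval Y) unit_interval) Y
     (\<lambda>(\<alpha>, t). \<alpha> t)"
proof -
  let ?C = "compact_open_topology unit_interval Y"
  let ?D = "prod_topology ?C unit_interval"
  have maps: "\<alpha> t \<in> topspace Y" if "\<alpha> \<in> topspace ?C" "t \<in> {0..1}" for \<alpha> t
    using that by (auto simp: topspace_compact_open_topology continuous_map_def)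
  have "openin ?D {w \<in> topspace ?D. (\<lambda>(\<alpha>, t). \<alpha> t) w \<in> U}" if U: "openin Y U" for U
  proof (subst openin_subopen, intro ballI)
    fix w assume w: "w \<in> {w \<in> topspace ?D. (\<lambda>(\<alpha>, t). \<alpha> t) w \<in> U}"
    obtain \<alpha> t where wt: "w = (\<alpha>, t)" by (cases w)
    with w have \<alpha>: "\<alpha> \<in> topspace ?C" and t: "t \<in> {0..1}" and \<alpha>t: "\<alpha> t \<in> U" by auto
    from \<alpha> have c: "continuous_map unit_interval Y \<alpha>" and ext: "\<alpha> \<in> extensional {0..1}"
      by (auto simp: topspace_compact_open_topology)
    have "openin unit_interval {s \<in> topspace unit_interval. \<alpha> s \<in> U}"
      using c U by (rule openin_continuous_map_preimage)
    then obtain T where T: "open T" "{s \<in> {0..1}. \<alpha> s \<in> U} = T \<inter> {0..1}"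
      unfolding openin_subtopology by auto
    with t \<alpha>t have "t \<in> T" by blast
    with T(1) obtain \<epsilon> where \<epsilon>: "\<epsilon> > 0" "cball t \<epsilon> \<subseteq> T"
      using open_contains_cball by blast
    let ?K = "cball t \<epsilon> \<inter> {0..1}"
    have K: "compactin unit_interval ?K"
      by (auto simp: compactin_subtopology intro: compact_Int)
    let ?W = "{\<alpha>. continuous_map unit_interval Y \<alpha> \<and> \<alpha> \<in> extensional (topspace unit_interval) \<and>
               \<alpha> ` ?K \<subseteq> U}"
    let ?V = "ball t \<epsilon> \<inter> {0..1}"
    have "openin ?C ?W" using K U by (rule openin_compact_open_topology)
    moreover have "openin unit_interval ?V"
      unfolding openin_subtopology by auto
    ultimately have "openin ?D (?W \<times> ?V)" by (simp add: openin_prod_Times_iff)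
    moreover have "w \<in> ?W \<times> ?V"
    proof -
      have "\<alpha> ` ?K \<subseteq> U" using \<epsilon>(2) T(2) by blast
      then show ?thesis using wt c ext t \<epsilon>(1) by simp
    qed
    moreover have "?W \<times> ?V \<subseteq> {w \<in> topspace ?D. (\<lambda>(\<alpha>, t). \<alpha> t) w \<in> U}"
    proof
      fix v assume "v \<in> ?W \<times> ?V"
      then obtain \<beta> s where v: "v = (\<beta>, s)" "\<beta> \<in> ?W" "s \<in> ?V" by blast
      then have "s \<in> ?K" by auto
      with v show "v \<in> {w \<in> topspace ?D. (\<lambda>(\<alpha>, t). \<alpha> t) w \<in> U}"
        by (auto simp: topspace_compact_open_topology)
    qed
    ultimately show "\<exists>T. openin ?D T \<and> w \<in> T \<and>
        T \<subseteq> {w \<in> topspace ?D. (\<lambda>(\<alpha>, t). \<alpha> t) w \<in> U}" by blast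
  qed
  then show ?thesis
    using maps unfolding continuous_map_def by auto
qed

lemma hurewicz_fibration_imp_homotopy_lifting_property:
  fixes E :: "'a topology" and X :: "'b topology" and Z :: "'z topology"
  assumes hur: "hurewicz_fibration E X p"
  shows "homotopy_lifting_property E X p Z"
  unfolding homotopy_lifting_property_def
proof (intro allI impI)
  fix f g
  assume f: "continuous_map Z E f"
    and g: "continuous_map (prod_topology Z unit_interval) X g"
    and fg: "\<forall>z \<in> topspace Z. p (f z) = g (z, 0)"
  let ?C = "compact_open_topology unit_interval X"
  define N where "N = subtopology (prod_topology E ?C) {(e, \<alpha>). p e = \<alpha> 0}"
  define f0 :: "'a \<times> (real \<Rightarrow> 'b) \<Rightarrow> 'a" where "f0 = fst"
  define g0 :: "('a \<times> (real \<Rightarrow> 'b)) \<times> real \<Rightarrow> 'b" where "g0 = (\<lambda>(n, t). snd n t)"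
  define \<phi> where "\<phi> = (\<lambda>z. (f z, restrict (\<lambda>t. g (z, t)) {0..1}))"
  have f0: "continuous_map N E f0"
    unfolding N_def f0_def by (intro continuous_map_from_subtopology continuous_map_fst)
  have sndN: "continuous_map N ?C snd"
    unfolding N_def by (intro continuous_map_from_subtopology continuous_map_snd)
  have "continuous_map (prod_topology N unit_interval) (prod_topology ?C unit_interval)
          (\<lambda>w. (snd (fst w), snd w))"
    by (intro continuous_map_pairedI continuous_map_snd
        continuous_map_compose[OF continuous_map_fst sndN, unfolded o_def])
  from continuous_map_compose[OF this continuous_map_path_eval]
  have g0: "continuous_map (prod_topology N unit_interval) X g0"
    by (simp add: o_def g0_def case_prod_unfold)
  have "\<forall>n \<in> topspace N. p (f0 n) = g0 (n, 0)"
    by (auto simp: N_def f0_def g0_def)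
  moreover have "homotopy_lifting_property E X p N"
    using hur unfolding hurewicz_fibration_def by blast
  ultimately have "\<exists>h. continuous_map (prod_topology N unit_interval) E h \<and>
      (\<forall>n \<in> topspace N. \<forall>t \<in> {0..1}. p (h (n, t)) = g0 (n, t)) \<and>
      (\<forall>n \<in> topspace N. h (n, 0) = f0 n)"
    using f0 g0 unfolding homotopy_lifting_property_def by simp
  then obtain h0 where h0: "continuous_map (prod_topology N unit_interval) E h0"
    and ph0: "\<And>n t. n \<in> topspace N \<Longrightarrow> t \<in> {0..1} \<Longrightarrow> p (h0 (n, t)) = g0 (n, t)"
    and h00: "\<And>n. n \<in> topspace N \<Longrightarrow> h0 (n, 0) = f0 n"
    by blast
  have "continuous_map Z ?C (\<lambda>z. restrict (\<lambda>t. g (z, t)) {0..1})"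
    using continuous_map_curry[OF g] by simp
  then have \<phi>: "continuous_map Z N \<phi>"
    unfolding N_def \<phi>_def
    using f fg by (auto simp: continuous_map_in_subtopology intro: continuous_map_pairedI)
  have \<phi>N: "\<phi> z \<in> topspace N" if "z \<in> topspace Z" for z
    using \<phi> that by (auto simp: continuous_map_def)
  let ?h = "\<lambda>w. h0 (\<phi> (fst w), snd w)"
  have "continuous_map (prod_topology Z unit_interval) (prod_topology N unit_interval)
          (\<lambda>w. (\<phi> (fst w), snd w))"
    by (intro continuous_map_pairedI continuous_map_snd
        continuous_map_compose[OF continuous_map_fst \<phi>, unfolded o_def])
  from continuous_map_compose[OF this h0]
  have "continuous_map (prod_topology Z unit_interval) E ?h" by (simp add: o_def)
  moreover have "\<forall>z \<in> topspace Z. \<forall>t \<in> {0..1}. p (?h (z, t)) = g (z, t)"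
    using ph0 \<phi>N by (simp add: g0_def \<phi>_def)
  moreover have "\<forall>z \<in> topspace Z. ?h (z, 0) = f z"
    using h00 \<phi>N by (simp add: f0_def \<phi>_def)
  ultimately show "\<exists>h. continuous_map (prod_topology Z unit_interval) E h \<and>
                 (\<forall>z \<in> topspace Z. \<forall>t \<in> {0..1}. p (h (z, t)) = g (z, t)) \<and>
                 (\<forall>z \<in> topspace Z. h (z, 0) = f z)" by blast
qed

end

theory Submission
  imports Defs
begin

text \<open>
  For (3) implies (4), let \<open>\<alpha>\<close> and \<open>\<beta>\<close> be lifts of one path \<open>\<sigma>\<close> with the same starting point.
  The reverse of \<open>\<alpha>\<close> followed by \<open>\<beta>\<close> lies over \<open>\<lambda>s. \<sigma> \<bar>1 - 2 s\<bar>\<close>, and lifting the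
  null homotopy \<open>\<lambda>(s, t). \<sigma> (max \<bar>1 - 2 s\<bar> t)\<close> joins \<open>\<alpha> 1\<close> to \<open>\<beta> 1\<close> by three paths in one fiber.
  For (1) implies (2), lift the evaluation homotopy \<open>P(X, p e) \<times> I \<rightarrow> X\<close> starting from the
  constant map \<open>e\<close>; the adjoint of the lift is the inverse of \<open>P(p)\<close>.
  For (2) implies (3), \<open>P(p)\<^sup>-\<^sup>1\<close> is continuous only for a fixed base point, so a
  contraction of the cube is used to prepend to each \<open>g(z, -)\<close> the image of a path
  in \<open>E\<close> running from a fixed point to \<open>f z\<close>.
\<close>

section \<open>Path spaces and the exponential law for the unit interval\<close>

lemma topspace_path_space:
  "topspace (path_space Y y) = {\<alpha>. pathin Y \<alpha> \<and> \<alpha> \<in> extensional {0..1} \<and> \<alpha> 0 = y}"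
  by (auto simp: path_space_def topspace_compact_open_topology pathin_def)

lemma pathin_restrict: "pathin Y (restrict \<alpha> {0..1}) \<longleftrightarrow> pathin Y \<alpha>"
  unfolding pathin_def by (auto intro: continuous_map_eq)

lemma restrict_in_path_space:
  assumes "pathin Y \<alpha>"
  shows "restrict \<alpha> {0..1} \<in> topspace (path_space Y (\<alpha> 0))"
  using assms by (simp add: topspace_path_space pathin_restrict)

lemma pathin_in_topspace: "pathin Y \<alpha> \<Longrightarrow> t \<in> {0..1} \<Longrightarrow> \<alpha> t \<in> topspace Y"
  by (auto simp: pathin_def continuous_map_def)

lemma pathin_reparametrize:
  assumes "pathin Y \<alpha>" "continuous_map Z unit_interval r"
  shows "continuous_map Z Y (\<lambda>z. \<alpha> (r z))"
  using continuous_map_compose[OF assms(2) assms(1)[unfolded pathin_def]] by (simp add: o_def)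

text \<open>This half of the exponential law rests on joint continuity of evaluation,
  \<open>continuous_map_path_eval\<close>, which comes from the local compactness of the
  interval.\<close>

lemma continuous_map_uncurry_path:
  assumes "continuous_map Z (path_space Y y) \<phi>"
  shows "continuous_map (prod_topology Z unit_interval) Y (\<lambda>(z, t). \<phi> z t)"
proof -
  let ?C = "compact_open_topology unit_interval Y"
  have "continuous_map Z ?C \<phi>"
    using assms by (simp add: path_space_def continuous_map_in_subtopology)
  then have "continuous_map (prod_topology Z unit_interval) (prod_topology ?C unit_interval)
          (\<lambda>w. (\<phi> (fst w), snd w))"
    by (intro continuous_map_pairedI continuous_map_snd
        continuous_map_compose[OF continuous_map_fst, unfolded o_def])
  from continuous_map_compose[OF this continuous_map_path_eval]
  show ?thesis by (simp add: o_def case_prod_unfold)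
qed

lemma continuous_map_curry_path:
  assumes g: "continuous_map (prod_topology Z unit_interval) Y g"
    and g0: "\<And>z. z \<in> topspace Z \<Longrightarrow> g (z, 0) = y"
  shows "continuous_map Z (path_space Y y) (\<lambda>z. restrict (\<lambda>t. g (z, t)) {0..1})"
  using continuous_map_curry[OF g] g0
  by (simp add: path_space_def continuous_map_in_subtopology)

lemma continuous_map_slice:
  assumes "continuous_map (prod_topology Z A) Y g" "z \<in> topspace Z"
  shows "continuous_map A Y (\<lambda>a. g (z, a))"
proof -
  have "continuous_map A (prod_topology Z A) (\<lambda>a. (z, a))"
    using assms(2) by (simp add: continuous_map_pairedI)
  from continuous_map_compose[OF this assms(1)] show ?thesis by (simp add: o_def)
qed

lemma path_map_in_path_space:
  assumes p: "continuous_map E X p" and \<alpha>: "\<alpha> \<in> topspace (path_space E e)"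
  shows "path_map p \<alpha> \<in> topspace (path_space X (p e))"
proof -
  have "pathin X (p \<circ> \<alpha>)" and "\<alpha> 0 = e"
    using \<alpha> p by (auto simp: topspace_path_space pathin_compose)
  then show ?thesis
    using restrict_in_path_space[of X "p \<circ> \<alpha>"]
    by (simp add: path_map_def compose_def o_def)
qed

text \<open>By adjunction: uncurrying the identity of the path space gives evaluation, and
  \<open>path_map p\<close> is the adjoint of evaluation followed by \<open>p\<close>. Subbasic open
  sets never appear.\<close>

lemma continuous_map_path_map:
  assumes p: "continuous_map E X p"
  shows "continuous_map (path_space E e) (path_space X (p e)) (path_map p)"
proof -
  have "continuous_map (prod_topology (path_space E e) unit_interval) E (\<lambda>(\<alpha>, t). \<alpha> t)"
    by (rule continuous_map_uncurry_path) (rule continuous_map_id[unfolded id_def])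
  from continuous_map_compose[OF this p]
  have "continuous_map (prod_topology (path_space E e) unit_interval) X (\<lambda>(\<alpha>, t). p (\<alpha> t))"
    by (simp add: o_def case_prod_unfold)
  from continuous_map_curry_path[OF this, of "p e"] show ?thesis
    by (simp add: topspace_path_space path_map_def compose_def[abs_def])
qed

text \<open>Injectivity of \<open>path_map p\<close> concerns extensional representatives.
  Restricting both paths to \<open>{0..1}\<close> extends it to arbitrary functions that are paths
  on the interval, such as reparametrizations.\<close>

lemma path_covering_property_unique:
  assumes pcp: "path_covering_property E X p"
    and \<alpha>: "pathin E \<alpha>" and \<beta>: "pathin E \<beta>" and eq0: "\<alpha> 0 = \<beta> 0"
    and peq: "\<And>t. t \<in> {0..1} \<Longrightarrow> p (\<alpha> t) = p (\<beta> t)" and t: "t \<in> {0..1}"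
  shows "\<alpha> t = \<beta> t"
proof -
  have "\<alpha> 0 \<in> topspace E" using pathin_in_topspace[OF \<alpha>] by simp
  then have "inj_on (path_map p) (topspace (path_space E (\<alpha> 0)))"
    using pcp unfolding path_covering_property_def bij_betw_def by blast
  moreover have "path_map p (restrict \<alpha> {0..1}) = path_map p (restrict \<beta> {0..1})"
    using peq by (auto simp: path_map_def compose_def fun_eq_iff)
  ultimately have "restrict \<alpha> {0..1} = restrict \<beta> {0..1}"
    using restrict_in_path_space[OF \<alpha>] restrict_in_path_space[OF \<beta>] eq0
    by (auto dest: inj_onD)
  then show ?thesis using t by (metis restrict_apply')
qed

section \<open>Lifting paths and path homotopies in Serre fibrations\<close>

lemma homotopy_lifting_property_homeomorphic:
  assumes hlp: "homotopy_lifting_property E X p Z" and hom: "Z homeomorphic_space Z'"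
  shows "homotopy_lifting_property E X p Z'"
  unfolding homotopy_lifting_property_def
proof (intro allI impI)
  fix f g
  assume f: "continuous_map Z' E f"
    and g: "continuous_map (prod_topology Z' unit_interval) X g"
    and fg: "\<forall>z \<in> topspace Z'. p (f z) = g (z, 0)"
  obtain u v where u: "continuous_map Z Z' u" and v: "continuous_map Z' Z v"
    and uv: "\<And>z. z \<in> topspace Z' \<Longrightarrow> u (v z) = z"
    using hom unfolding homeomorphic_space_def homeomorphic_maps_def by blast
  have "continuous_map (prod_topology Z unit_interval) (prod_topology Z' unit_interval)
          (\<lambda>w. (u (fst w), snd w))"
    by (intro continuous_map_pairedI continuous_map_snd
        continuous_map_compose[OF continuous_map_fst u, unfolded o_def])
  from continuous_map_compose[OF this g]
  have "continuous_map (prod_topology Z unit_interval) X (\<lambda>w. g (u (fst w), snd w))"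
    by (simp add: o_def)
  moreover have "continuous_map Z E (f \<circ> u)" using u f by (rule continuous_map_compose)
  moreover have "\<forall>z \<in> topspace Z. p ((f \<circ> u) z) = g (u (fst (z, 0)), snd (z, 0))"
    using fg u by (auto simp: continuous_map_def)
  ultimately obtain h where h: "continuous_map (prod_topology Z unit_interval) E h"
    and ph: "\<And>z t. z \<in> topspace Z \<Longrightarrow> t \<in> {0..1} \<Longrightarrow> p (h (z, t)) = g (u z, t)"
    and h0: "\<And>z. z \<in> topspace Z \<Longrightarrow> h (z, 0) = f (u z)"
    using hlp[unfolded homotopy_lifting_property_def, rule_format,
        of "f \<circ> u" "\<lambda>w. g (u (fst w), snd w)"] by auto
  have "continuous_map (prod_topology Z' unit_interval) (prod_topology Z unit_interval)
          (\<lambda>w. (v (fst w), snd w))"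
    by (intro continuous_map_pairedI continuous_map_snd
        continuous_map_compose[OF continuous_map_fst v, unfolded o_def])
  from continuous_map_compose[OF this h]
  have "continuous_map (prod_topology Z' unit_interval) E (\<lambda>w. h (v (fst w), snd w))"
    by (simp add: o_def)
  moreover have "v z \<in> topspace Z" if "z \<in> topspace Z'" for z
    using v that by (auto simp: continuous_map_def)
  ultimately show "\<exists>h. continuous_map (prod_topology Z' unit_interval) E h \<and>
      (\<forall>z \<in> topspace Z'. \<forall>t \<in> {0..1}. p (h (z, t)) = g (z, t)) \<and>
      (\<forall>z \<in> topspace Z'. h (z, 0) = f z)"
    using ph h0 uv by (intro exI[of _ "\<lambda>w. h (v (fst w), snd w)"]) auto
qed

text \<open>Points of \<open>cube 1\<close> are functions on a one-element index set, so a
  homeomorphism is needed to pass to the interval itself.\<close>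

lemma serre_fibration_lift_path_homotopy:
  assumes "serre_fibration E X p"
  shows "homotopy_lifting_property E X p unit_interval"
proof -
  have "cube 1 homeomorphic_space unit_interval"
    using homeomorphic_space_singleton_product[of "\<lambda>_. unit_interval" "0::nat"]
    by (simp add: cube_def lessThan_Suc)
  then show ?thesis
    using assms homotopy_lifting_property_homeomorphic
    unfolding serre_fibration_def by blast
qed

text \<open>A path is a homotopy on the one-point space \<open>cube 0\<close>.\<close>

lemma serre_fibration_lift_path:
  assumes s: "serre_fibration E X p" and e: "e \<in> topspace E"
    and \<sigma>: "pathin X \<sigma>" and \<sigma>0: "\<sigma> 0 = p e"
  obtains \<alpha> where "pathin E \<alpha>" "\<alpha> 0 = e" "\<And>t. t \<in> {0..1} \<Longrightarrow> p (\<alpha> t) = \<sigma> t"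
proof -
  \<comment> \<open>The product over the empty index set has a single point, the extensional
    function that is \<open>undefined\<close> everywhere.\<close>
  let ?z = "\<lambda>_::nat. undefined :: real"
  have z: "topspace (cube 0) = {?z}" by (simp add: cube_def)
  have "continuous_map (prod_topology (cube 0) unit_interval) X (\<lambda>w. \<sigma> (snd w))"
    using \<sigma> continuous_map_snd by (rule pathin_reparametrize)
  moreover have "homotopy_lifting_property E X p (cube 0)"
    using s by (simp add: serre_fibration_def)
  ultimately obtain h where h: "continuous_map (prod_topology (cube 0) unit_interval) E h"
    and ph: "\<And>t. t \<in> {0..1} \<Longrightarrow> p (h (?z, t)) = \<sigma> t" and h0: "h (?z, 0) = e"
    unfolding homotopy_lifting_property_def z using e \<sigma>0
    by (auto dest!: spec[of _ "\<lambda>_. e"] spec[of _ "\<lambda>w. \<sigma> (snd w)"])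
  have "pathin E (\<lambda>t. h (?z, t))"
    unfolding pathin_def using h by (rule continuous_map_slice) (simp add: z)
  then show thesis using that ph h0 by blast
qed

text \<open>Serves to identify adjacent corners of a lifted square along a side that stays in one
  fiber.\<close>

lemma totally_path_disconnected_fibers_path_constant:
  assumes "totally_path_disconnected_fibers E X p" and \<gamma>: "pathin E \<gamma>"
    and x: "x \<in> topspace X" "\<And>t. t \<in> {0..1} \<Longrightarrow> p (\<gamma> t) = x"
  shows "\<gamma> 0 = \<gamma> 1"
proof -
  have "pathin (subtopology E {e \<in> topspace E. p e = x}) \<gamma>"
    using \<gamma> x(2) pathin_in_topspace[OF \<gamma>] by (auto simp: pathin_subtopology)
  then obtain c where "\<forall>t \<in> {0..1}. \<gamma> t = c"
    using assms(1) x(1)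
    unfolding totally_path_disconnected_fibers_def totally_path_disconnected_space_def by blast
  then show ?thesis by simp
qed

section \<open>Uniqueness of lifts and bijectivity of the induced map on paths\<close>

lemma serre_fibration_unique_lift_endpoint:
  assumes s: "serre_fibration E X p" and tpd: "totally_path_disconnected_fibers E X p"
    and \<alpha>: "pathin E \<alpha>" and \<beta>: "pathin E \<beta>" and eq0: "\<alpha> 0 = \<beta> 0"
    and peq: "\<And>t. t \<in> {0..1} \<Longrightarrow> p (\<alpha> t) = p (\<beta> t)"
  shows "\<alpha> 1 = \<beta> 1"
proof -
  define \<gamma> where "\<gamma> = (\<lambda>s::real. if s \<le> 1/2 then \<alpha> (1 - 2 * s) else \<beta> (2 * s - 1))"
  \<comment> \<open>The maximum equals 1 on the sides \<open>s = 0\<close>, \<open>s = 1\<close> and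
    \<open>t = 1\<close>, so \<open>G\<close> is constantly \<open>p (\<alpha> 1)\<close> there; on
    the side \<open>t = 0\<close> it is \<open>\<bar>1 - 2 * s\<bar>\<close>, which gives the image
    of \<open>\<gamma>\<close>.\<close>
  define G where "G = (\<lambda>w::real \<times> real. p (\<alpha> (max \<bar>1 - 2 * fst w\<bar> (snd w))))"
  have "continuous_map unit_interval E \<gamma>"
    unfolding \<gamma>_def
  proof (rule continuous_map_cases_le)
    show "continuous_map (subtopology unit_interval {s \<in> topspace unit_interval. s \<le> 1/2}) E
            (\<lambda>s. \<alpha> (1 - 2 * s))"
      by (rule pathin_reparametrize[OF \<alpha>])
        (auto simp: subtopology_subtopology intro!: continuous_intros)
    show "continuous_map (subtopology unit_interval {s \<in> topspace unit_interval. 1/2 \<le> s}) E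
            (\<lambda>s. \<beta> (2 * s - 1))"
      by (rule pathin_reparametrize[OF \<beta>])
        (auto simp: subtopology_subtopology intro!: continuous_intros)
    show "\<alpha> (1 - 2 * s) = \<beta> (2 * s - 1)" if "s = 1/2" for s
      unfolding that using eq0 by simp
  qed (auto intro!: continuous_intros)
  moreover have "continuous_map (prod_topology unit_interval unit_interval) X G"
  proof -
    have p\<alpha>: "pathin X (p \<circ> \<alpha>)"
      using \<alpha> s by (auto intro: pathin_compose simp: serre_fibration_def)
    have "continuous_map (prod_topology unit_interval unit_interval) unit_interval
        (\<lambda>w. max \<bar>1 - 2 * fst w\<bar> (snd w))"
      unfolding prod_topology_subtopology_eu by (auto intro!: continuous_intros)
    from pathin_reparametrize[OF p\<alpha> this] show ?thesis
      by (simp add: G_def)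
  qed
  \<comment> \<open>On the second half \<open>\<gamma>\<close> follows \<open>\<beta>\<close>, and
    \<open>peq\<close> exchanges \<open>p (\<beta> (2 * s - 1))\<close> for
    \<open>p (\<alpha> (2 * s - 1))\<close>.\<close>
  moreover have "\<forall>s \<in> topspace unit_interval. p (\<gamma> s) = G (s, 0)"
    using peq by (auto simp: \<gamma>_def G_def abs_if)
  ultimately obtain h where h: "continuous_map (prod_topology unit_interval unit_interval) E h"
    and ph: "\<And>s t. s \<in> {0..1} \<Longrightarrow> t \<in> {0..1} \<Longrightarrow> p (h (s, t)) = G (s, t)"
    and h0: "\<And>s. s \<in> {0..1} \<Longrightarrow> h (s, 0) = \<gamma> s"
    using serre_fibration_lift_path_homotopy[OF s,
        unfolded homotopy_lifting_property_def, rule_format, of \<gamma> G] by auto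
  have x: "p (\<alpha> 1) \<in> topspace X"
    using \<alpha> s pathin_in_topspace[OF \<alpha>, of 1] by (auto simp: serre_fibration_def continuous_map_def)
  have side: "h (s, 0) = h (s, 1)" if "s = 0 \<or> s = 1" for s
    using that
    by (intro totally_path_disconnected_fibers_path_constant[OF tpd _ x, of "\<lambda>t. h (s, t)"])
      (auto simp: pathin_def ph G_def intro!: continuous_map_slice[OF h])
  have "continuous_map unit_interval (prod_topology unit_interval unit_interval) (\<lambda>s. (s, 1))"
    by (auto intro!: continuous_intros)
  from continuous_map_compose[OF this h] have "pathin E (\<lambda>s. h (s, 1))"
    by (simp add: pathin_def o_def)
  then have "h (0, 1) = h (1, 1)"
    by (rule totally_path_disconnected_fibers_path_constant[OF tpd _ x])
      (auto simp: ph G_def max_def)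
  \<comment> \<open>Around the square: \<open>\<alpha> 1 = \<gamma> 0 = h (0, 0) = h (0, 1) = h (1,
    1) = h (1, 0) = \<gamma> 1 = \<beta> 1\<close>.\<close>
  with side[of 0] side[of 1] h0[of 0] h0[of 1] show ?thesis
    by (simp add: \<gamma>_def)
qed

lemma serre_fibration_imp_path_covering_property:
  assumes s: "serre_fibration E X p" and tpd: "totally_path_disconnected_fibers E X p"
  shows "path_covering_property E X p"
  unfolding path_covering_property_def
proof
  fix e assume e: "e \<in> topspace E"
  have p: "continuous_map E X p" using s by (simp add: serre_fibration_def)
  show "bij_betw (path_map p) (topspace (path_space E e)) (topspace (path_space X (p e)))"
  proof (rule bij_betw_imageI)
    show "inj_on (path_map p) (topspace (path_space E e))"
    proof (rule inj_onI)
      fix \<alpha> \<beta>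
      assume \<alpha>: "\<alpha> \<in> topspace (path_space E e)" and \<beta>: "\<beta> \<in> topspace (path_space E e)"
        and eq: "path_map p \<alpha> = path_map p \<beta>"
      have peq: "p (\<alpha> t) = p (\<beta> t)" if "t \<in> {0..1}" for t
        using fun_cong[OF eq, of t] that by (simp add: path_map_def compose_def)
      \<comment> \<open>Comparing endpoints is enough: the initial segments up to time
        \<open>t\<close>, rescaled by \<open>s \<mapsto> t * s\<close>, are again lifts of one path,
        with endpoints \<open>\<alpha> t\<close> and \<open>\<beta> t\<close>.\<close>
      have "\<alpha> t = \<beta> t" if t: "t \<in> {0..1}" for t
      proof -
        have scale: "continuous_map unit_interval unit_interval (\<lambda>s. t * s)"
          using t by (auto intro!: continuous_intros mult_le_one)
        have "\<alpha> (t * 1) = \<beta> (t * 1)"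
        proof (rule serre_fibration_unique_lift_endpoint[OF s tpd])
          show "pathin E (\<lambda>s. \<alpha> (t * s))" "pathin E (\<lambda>s. \<beta> (t * s))"
            using \<alpha> \<beta> pathin_reparametrize[OF _ scale]
            by (auto simp: topspace_path_space pathin_def)
          show "p (\<alpha> (t * s)) = p (\<beta> (t * s))" if "s \<in> {0..1}" for s
            using that t by (intro peq) (auto intro: mult_le_one)
        qed (use \<alpha> \<beta> in \<open>auto simp: topspace_path_space\<close>)
        then show ?thesis by simp
      qed
      then show "\<alpha> = \<beta>"
        using \<alpha> \<beta> by (auto simp: topspace_path_space intro: extensionalityI)
    qed
    show "path_map p ` topspace (path_space E e) = topspace (path_space X (p e))"
    proof (intro equalityI subsetI)
      fix \<sigma> assume \<sigma>: "\<sigma> \<in> topspace (path_space X (p e))"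
      then obtain \<alpha> where \<alpha>: "pathin E \<alpha>" "\<alpha> 0 = e" "\<And>t. t \<in> {0..1} \<Longrightarrow> p (\<alpha> t) = \<sigma> t"
        using serre_fibration_lift_path[OF s e] by (auto simp: topspace_path_space)
      have "path_map p (restrict \<alpha> {0..1}) = \<sigma>"
        using \<sigma> \<alpha>(3)
        by (auto simp: path_map_def compose_def topspace_path_space extensional_def fun_eq_iff)
      then show "\<sigma> \<in> path_map p ` topspace (path_space E e)"
        using restrict_in_path_space[OF \<alpha>(1)] \<alpha>(2) by blast
    qed (use path_map_in_path_space[OF p] in blast)
  qed
qed

section \<open>Continuous dependence of lifts for Hurewicz fibrations\<close>

lemma hurewicz_fibration_imp_continuous_path_covering_property:
  assumes hur: "hurewicz_fibration E X p" and tpd: "totally_path_disconnected_fibers E X p"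
  shows "continuous_path_covering_property E X p"
  unfolding continuous_path_covering_property_def
proof
  fix e assume e: "e \<in> topspace E"
  let ?P = "path_space X (p e)"
  have p: "continuous_map E X p" using hur by (simp add: hurewicz_fibration_def)
  \<comment> \<open>The detour through cubes supplies uniqueness of lifts; the Hurewicz property
    itself is then used for continuity of the lifting.\<close>
  have "serre_fibration E X p"
    using p by (simp add: serre_fibration_def
        hurewicz_fibration_imp_homotopy_lifting_property[OF hur])
  then have "path_covering_property E X p"
    using tpd by (rule serre_fibration_imp_path_covering_property)
  then have inj: "inj_on (path_map p) (topspace (path_space E e))"
    using e unfolding path_covering_property_def bij_betw_def by blast
  have "continuous_map (prod_topology ?P unit_interval) X (\<lambda>(\<sigma>, t). \<sigma> t)"
    by (rule continuous_map_uncurry_path) (rule continuous_map_id[unfolded id_def])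
  moreover have "\<forall>\<sigma> \<in> topspace ?P. p e = (\<lambda>(\<sigma>, t). \<sigma> t) (\<sigma>, 0)"
    by (simp add: topspace_path_space)
  moreover have "continuous_map ?P E (\<lambda>_. e)" using e by simp
  ultimately obtain h where h: "continuous_map (prod_topology ?P unit_interval) E h"
    and ph: "\<And>\<sigma> t. \<sigma> \<in> topspace ?P \<Longrightarrow> t \<in> {0..1} \<Longrightarrow> p (h (\<sigma>, t)) = \<sigma> t"
    and h0: "\<And>\<sigma>. \<sigma> \<in> topspace ?P \<Longrightarrow> h (\<sigma>, 0) = e"
    using hurewicz_fibration_imp_homotopy_lifting_property[OF hur, of ?P,
        unfolded homotopy_lifting_property_def, rule_format, of "\<lambda>_. e" "\<lambda>(\<sigma>, t). \<sigma> t"]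
    by auto
  define L where "L = (\<lambda>\<sigma>. restrict (\<lambda>t. h (\<sigma>, t)) {0..1})"
  have L: "continuous_map ?P (path_space E e) L"
    unfolding L_def using h h0 by (rule continuous_map_curry_path)
  have pL: "path_map p (L \<sigma>) = \<sigma>" if "\<sigma> \<in> topspace ?P" for \<sigma>
    using that ph
    by (auto simp: path_map_def compose_def L_def topspace_path_space extensional_def fun_eq_iff)
  \<comment> \<open>Both sides start at \<open>e\<close> and lift the same path, so injectivity
    turns the right inverse \<open>L\<close> into a two-sided one.\<close>
  have "L (path_map p \<alpha>) = \<alpha>" if \<alpha>: "\<alpha> \<in> topspace (path_space E e)" for \<alpha>
  proof (rule inj_onD[OF inj])
    have "path_map p \<alpha> \<in> topspace ?P" using p \<alpha> by (rule path_map_in_path_space)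
    then show "path_map p (L (path_map p \<alpha>)) = path_map p \<alpha>"
      and "L (path_map p \<alpha>) \<in> topspace (path_space E e)"
      using pL L by (auto simp: continuous_map_def)
  qed (rule \<alpha>)
  then have "homeomorphic_maps (path_space E e) ?P (path_map p) L"
    unfolding homeomorphic_maps_def using continuous_map_path_map[OF p] L pL by blast
  then show "homeomorphic_map (path_space E e) ?P (path_map p)"
    by (auto simp: homeomorphic_map_maps)
qed

section \<open>Consequences of continuous path covering: fibers and lifting over cubes\<close>

lemma continuous_path_covering_property_imp_path_covering_property:
  "continuous_path_covering_property E X p \<Longrightarrow> path_covering_property E X p"
  unfolding continuous_path_covering_property_def path_covering_property_def
  by (auto simp: homeomorphic_eq_everything_map bij_betw_def)

text \<open>A path in a fiber and the constant path at its starting point lie over the same constant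
  path, so they coincide.\<close>

lemma path_covering_property_imp_totally_path_disconnected_fibers:
  assumes "path_covering_property E X p"
  shows "totally_path_disconnected_fibers E X p"
  unfolding totally_path_disconnected_fibers_def totally_path_disconnected_space_def
proof (intro ballI allI impI)
  fix x \<alpha> assume "pathin (subtopology E {e \<in> topspace E. p e = x}) \<alpha>"
  then have \<alpha>: "pathin E \<alpha>" and x: "\<And>t. t \<in> {0..1} \<Longrightarrow> p (\<alpha> t) = x"
    by (auto simp: pathin_subtopology)
  have "\<alpha> t = (\<lambda>_. \<alpha> 0) t" if "t \<in> {0..1}" for t
  proof (rule path_covering_property_unique[OF assms \<alpha>])
    show "pathin E (\<lambda>_. \<alpha> 0)"
      using pathin_in_topspace[OF \<alpha>] by (simp add: pathin_def)
  qed (use that x in auto)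
  then show "\<exists>c. \<forall>t \<in> {0..1}. \<alpha> t = c" by blast
qed

lemma continuous_path_covering_property_lift_contractible:
  assumes cpc: "continuous_path_covering_property E X p" and p: "continuous_map E X p"
    and Z: "contractible_space Z"
  shows "homotopy_lifting_property E X p Z"
  unfolding homotopy_lifting_property_def
proof (intro allI impI)
  fix f g
  assume f: "continuous_map Z E f"
    and g: "continuous_map (prod_topology Z unit_interval) X g"
    and fg: "\<forall>z \<in> topspace Z. p (f z) = g (z, 0)"
  let ?ZI = "prod_topology Z unit_interval"
  obtain a where "homotopic_with (\<lambda>_. True) Z Z (\<lambda>_. a) id"
    using Z unfolding contractible_space_def by (meson homotopic_with_sym)
  then obtain k where k: "continuous_map (prod_topology unit_interval Z) Z k"
    and k0: "\<And>z. k (0, z) = a" and k1: "\<And>z. k (1, z) = z"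
    unfolding homotopic_with_def by auto
  \<comment> \<open>\<open>c (z, -)\<close> is the path in \<open>E\<close> from the fixed point
    \<open>f a\<close> to \<open>f z\<close> traced by the contraction.\<close>
  define c where "c = (\<lambda>(z, t). f (k (t, z)))"
  have c: "continuous_map ?ZI E c"
    using continuous_map_compose[OF continuous_map_compose[OF _ k] f, of ?ZI "\<lambda>w. (snd w, fst w)"]
    by (simp add: c_def o_def case_prod_unfold continuous_map_pairedI continuous_map_fst
        continuous_map_snd)
  have c0: "c (z, 0) = f a" and c1: "c (z, 1) = f z" for z
    by (simp_all add: c_def k0 k1)
  \<comment> \<open>\<open>d (z, -)\<close> runs through the image of \<open>c (z, -)\<close> and
    then through \<open>g (z, -)\<close>, so that all these paths start at
    \<open>p (f a)\<close>.\<close>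
  define d where
    "d = (\<lambda>w. if snd w \<le> 1/2 then p (c (fst w, 2 * snd w)) else g (fst w, 2 * snd w - 1))"
  have d: "continuous_map ?ZI X d"
    unfolding d_def
  proof (rule continuous_map_cases_le)
    show "continuous_map ?ZI euclideanreal snd" "continuous_map ?ZI euclideanreal (\<lambda>_. 1/2)"
      using continuous_map_snd[of Z unit_interval] by (simp_all add: continuous_map_in_subtopology)
    \<comment> \<open>The rescaled times \<open>2 * snd w\<close> and \<open>2 * snd w - 1\<close>
      stay in the unit interval only on the matching half of the cylinder, whence the restriction to
      \<open>S\<close>.\<close>
    have reparametrize: "continuous_map (subtopology ?ZI S) ?ZI (\<lambda>w. (fst w, r (snd w)))"
      if "continuous_on UNIV r" and "\<And>w. w \<in> S \<Longrightarrow> r (snd w) \<in> {0..1}" for r :: "real \<Rightarrow> real" and S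
    proof (intro continuous_map_pairedI)
      have "continuous_map (subtopology ?ZI S) euclideanreal snd"
        using continuous_map_snd[of Z unit_interval]
        by (simp add: continuous_map_in_subtopology continuous_map_from_subtopology)
      from continuous_map_compose[OF this, of euclideanreal r] that
      show "continuous_map (subtopology ?ZI S) unit_interval (\<lambda>w. r (snd w))"
        by (auto simp: continuous_map_in_subtopology o_def)
    qed (intro continuous_map_from_subtopology continuous_map_fst)
    let ?lower = "{w \<in> topspace ?ZI. snd w \<le> 1/2}" and ?upper = "{w \<in> topspace ?ZI. 1/2 \<le> snd w}"
    have "continuous_map (subtopology ?ZI ?lower) ?ZI (\<lambda>w. (fst w, 2 * snd w))"
      by (rule reparametrize) (auto intro!: continuous_intros)
    from continuous_map_compose[OF this continuous_map_compose[OF c p]]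
    show "continuous_map (subtopology ?ZI ?lower) X (\<lambda>w. p (c (fst w, 2 * snd w)))"
      by (simp add: o_def)
    have "continuous_map (subtopology ?ZI ?upper) ?ZI (\<lambda>w. (fst w, 2 * snd w - 1))"
      by (rule reparametrize) (auto intro!: continuous_intros)
    from continuous_map_compose[OF this g]
    show "continuous_map (subtopology ?ZI ?upper) X (\<lambda>w. g (fst w, 2 * snd w - 1))"
      by (simp add: o_def)
    show "p (c (fst w, 2 * snd w)) = g (fst w, 2 * snd w - 1)"
      if w: "w \<in> topspace ?ZI" "snd w = 1/2" for w
    proof -
      obtain z where "w = (z, 1/2)" "z \<in> topspace Z"
        using w by (metis mem_Times_iff prod.collapse topspace_prod_topology)
      then show ?thesis using fg by (simp add: c1)
    qed
  qed
  show "\<exists>h. continuous_map ?ZI E h \<and>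
      (\<forall>z \<in> topspace Z. \<forall>t \<in> {0..1}. p (h (z, t)) = g (z, t)) \<and>
      (\<forall>z \<in> topspace Z. h (z, 0) = f z)"
  \<comment> \<open>For empty \<open>Z\<close> the point \<open>a\<close> is arbitrary and
    \<open>f a\<close> may lie outside \<open>E\<close>, so there would be no base point for the
    path space.\<close>
  proof (cases "topspace Z = {}")
    case True
    then show ?thesis
      by (intro exI[of _ "\<lambda>w. f (fst w)"]) (auto simp: continuous_map_def)
  next
    case False
    then have "a \<in> topspace Z"
      using k k0 by (fastforce simp: continuous_map_def)
    then have fa: "f a \<in> topspace E" using f by (auto simp: continuous_map_def)
    then obtain L where L: "homeomorphic_maps (path_space E (f a)) (path_space X (p (f a)))
        (path_map p) L"
      using cpc unfolding continuous_path_covering_property_def homeomorphic_map_maps by blast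
    define \<delta> where "\<delta> = (\<lambda>z. restrict (\<lambda>t. d (z, t)) {0..1})"
    have \<delta>: "continuous_map Z (path_space X (p (f a))) \<delta>"
      unfolding \<delta>_def using d by (rule continuous_map_curry_path) (simp add: d_def c0)
    have L\<delta>: "continuous_map Z (path_space E (f a)) (\<lambda>z. L (\<delta> z))"
      using continuous_map_compose[OF \<delta>] L by (auto simp: homeomorphic_maps_def o_def)
    have pL: "p (L (\<delta> z) t) = d (z, t)" if z: "z \<in> topspace Z" and t: "t \<in> {0..1}" for z t
    proof -
      have "path_map p (L (\<delta> z)) = \<delta> z"
        using L \<delta> z by (auto simp: homeomorphic_maps_def continuous_map_def)
      from fun_cong[OF this, of t] t show ?thesis
        by (simp add: path_map_def compose_def \<delta>_def)
    qed
    \<comment> \<open>The first half of \<open>L (\<delta> z)\<close>, run at half speed, and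
      \<open>c (z, -)\<close> both start at \<open>f a\<close> and have the same image under
      \<open>p\<close>. Uniqueness makes them equal, in particular at time 1.\<close>
    have half: "L (\<delta> z) (1/2) = f z" if z: "z \<in> topspace Z" for z
    proof -
      have Lz: "L (\<delta> z) \<in> topspace (path_space E (f a))"
        using L\<delta> z by (auto simp: continuous_map_def)
      have "L (\<delta> z) (1 / 2) = c (z, 1)"
      proof (rule path_covering_property_unique
          [OF continuous_path_covering_property_imp_path_covering_property[OF cpc],
            of "\<lambda>t. L (\<delta> z) (t / 2)" "\<lambda>t. c (z, t)" 1, simplified])
        show "pathin E (\<lambda>t. L (\<delta> z) (t / 2))"
          unfolding pathin_def using Lz
          by (intro pathin_reparametrize[of E "L (\<delta> z)"])
            (auto simp: topspace_path_space intro!: continuous_intros)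
        show "pathin E (\<lambda>t. c (z, t))"
          unfolding pathin_def using c z by (rule continuous_map_slice)
        show "L (\<delta> z) 0 = c (z, 0)"
          using Lz by (simp add: topspace_path_space c0)
        show "p (L (\<delta> z) (t / 2)) = p (c (z, t))" if "0 \<le> t \<and> t \<le> 1" for t
          using that z by (subst pL) (auto simp: d_def)
      qed
      then show ?thesis by (simp add: c1)
    qed
    \<comment> \<open>The second half of the lifted path: it starts at \<open>f z\<close> by
      \<open>half\<close> and lies over \<open>g (z, -)\<close>.\<close>
    define h where "h = (\<lambda>w. L (\<delta> (fst w)) ((1 + snd w) / 2))"
    have "continuous_map ?ZI euclideanreal snd"
      using continuous_map_snd[of Z unit_interval] by (simp add: continuous_map_in_subtopology)
    then have "continuous_map ?ZI euclideanreal (\<lambda>w. (1 + snd w) / 2)"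
      by (intro continuous_map_real_divide continuous_map_add) auto
    then have "continuous_map ?ZI ?ZI (\<lambda>w. (fst w, (1 + snd w) / 2))"
      by (intro continuous_map_pairedI continuous_map_fst)
        (auto simp: continuous_map_in_subtopology)
    from continuous_map_compose[OF this continuous_map_uncurry_path[OF L\<delta>]]
    have "continuous_map ?ZI E h" by (simp add: h_def o_def)
    moreover have "p (h (z, t)) = g (z, t)" if "z \<in> topspace Z" "t \<in> {0..1}" for z t
    proof -
      have "p (h (z, t)) = d (z, (1 + t) / 2)"
        using that by (simp add: h_def pL)
      \<comment> \<open>At \<open>t = 0\<close> the time is exactly \<open>1/2\<close>, which falls
        in the first branch of \<open>d\<close>; there \<open>c1\<close> and \<open>fg\<close> give
        \<open>p (f z) = g (z, 0)\<close>.\<close>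
      also have "\<dots> = g (z, t)"
        using that fg by (auto simp: d_def c1 add_divide_distrib)
      finally show ?thesis .
    qed
    moreover have "h (z, 0) = f z" if "z \<in> topspace Z" for z
      using half[OF that] by (simp add: h_def)
    ultimately show ?thesis by blast
  qed
qed

text \<open>Cubes are products of convex sets, hence contractible.\<close>

lemma continuous_path_covering_property_imp_serre_fibration:
  assumes "continuous_path_covering_property E X p" and "continuous_map E X p"
  shows "serre_fibration E X p"
proof -
  have "contractible_space (cube n)" for n
    by (simp add: cube_def contractible_space_product_topology convex_imp_contractible)
  then show ?thesis
    using assms continuous_path_covering_property_lift_contractible
    unfolding serre_fibration_def by blast
qed

theorem theorem1p1:
  fixes E :: "'a topology" and X :: "'b topology" and p :: "'a \<Rightarrow> 'b"
  assumes "topspace E \<noteq> {}" and "path_connected_space E"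
    and "topspace X \<noteq> {}" and "path_connected_space X"
    and "continuous_map E X p"
  shows "(hurewicz_fibration E X p \<and> totally_path_disconnected_fibers E X p
            \<longrightarrow> continuous_path_covering_property E X p) \<and>
         (continuous_path_covering_property E X p
            \<longrightarrow> serre_fibration E X p \<and> totally_path_disconnected_fibers E X p) \<and>
         (serre_fibration E X p \<and> totally_path_disconnected_fibers E X p
            \<longrightarrow> path_covering_property E X p)"
  using hurewicz_fibration_imp_continuous_path_covering_property
    continuous_path_covering_property_imp_serre_fibration[OF _ assms(5)]
    path_covering_property_imp_totally_path_disconnected_fibers
      [OF continuous_path_covering_property_imp_path_covering_property]
    serre_fibration_imp_path_covering_property
  by blast

end
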